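(* Let $N\in\mathbb{N}$, $p\in(0,1)$ and $1\le n\le N$. The roots $x_{1,n}^K<\dots<x_{n,n}^K$ of the Krawtchouk polynomial $K_n(x;p,N)$ are real, simple, located in $(0,N)$, have mutual distances greater than $1$, and form the equilibrium distribution of $n$ charges in $(0,N)$, with exclusion radius $h=1$, under the external field $\phi^K$ with force $$F_{\phi^K}(x)=-(\phi^K)'(x)=\frac12\log\left(\frac{p(N-x)}{(1-p)x}\right),\qquad x\in(0,N).$$ Moreover, for fixed $n$ and $p$, each root $x_{j,n}^K$, $j=1,\dots,n$, increases as $N$ increases.
   Context: Krawtchouk polynomials: $K_n(x;p,N)=\sum_{k=0}^n\frac{(-n)_k(-x)_k}{k!\,(-N)_k}\left(\frac1p\right)^k$, where $(u)_k=u(u+1)\cdots(u+k-1)$ is the Pochhammer symbol. They are orthogonal with respect to the discrete measure $\sum_{j=0}^N\binom{N}{j}p^j(1-p)^{N-j}\delta_j$. Equilibrium distribution with $h=1$: the unit-charge potential is $V_x(y)=\frac{x-y}{2}\log\left(\frac{y-x+1}{y-x-1}\right)-\frac12\log\big((y-x+1)(y-x-1)\big)$ for $|y-x|>1$, the energy is $\mathcal{E}_\phi(x_1,\dots,x_n)=\sum_{j\neq k}V_{x_k}(x_j)+2\sum_{j=1}^n\phi(x_j)$, and an equilibrium distribution of $n$ charges in $(\alpha,\beta)$ is a distribution $x_1<\dots<x_n$ with $x_{j+1}>x_j+1$ that minimizes $\mathcal{E}_\phi$ among all distributions of $n$ points in $(\alpha,\beta)$ with mutual distances greater than $1$. *)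

theory Defs
  imports Complex_Main "HOL-Computational_Algebra.Polynomial"
begin

definition krawtchouk :: "nat \<Rightarrow> real \<Rightarrow> nat \<Rightarrow> real poly" where
  "krawtchouk n p N =
     (\<Sum>k=0..n. smult (pochhammer (- real n) k / (fact k * pochhammer (- real N) k) * (1 / p) ^ k)
                  (pochhammer (- [:0, 1:]) k))"

lemma poly_krawtchouk:
  "poly (krawtchouk n p N) x =
     (\<Sum>k=0..n. pochhammer (- real n) k * pochhammer (- x) k
                  / (fact k * pochhammer (- real N) k) * (1 / p) ^ k)"
proof -
  have "poly (pochhammer (- [:0, 1:]) k) x = pochhammer (- x) k" for k
    by (induction k) (auto simp: pochhammer_Suc algebra_simps)
  then show ?thesis
    by (simp add: krawtchouk_def poly_sum mult_ac)
qed

text \<open>The \<open>j\<close>-th smallest real root; only meaningful for \<open>1 \<le> j\<close> up to the number of real roots.\<close>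
definition krawtchouk_root :: "nat \<Rightarrow> real \<Rightarrow> nat \<Rightarrow> nat \<Rightarrow> real" where
  "krawtchouk_root n p N j = sorted_list_of_set {x. poly (krawtchouk n p N) x = 0} ! (j - 1)"

text \<open>Potential at \<open>y\<close> of a unit charge at \<open>x\<close>, for exclusion radius 1;
  only meaningful for \<open>\<bar>y - x\<bar> > 1\<close>, where both logarithms have positive arguments.\<close>
definition charge_potential :: "real \<Rightarrow> real \<Rightarrow> real" where
  "charge_potential x y =
     (x - y) / 2 * ln ((y - x + 1) / (y - x - 1)) - 1 / 2 * ln ((y - x + 1) * (y - x - 1))"

text \<open>A distribution of \<open>n\<close> points is a function restricted to the indices \<open>{1..n}\<close>.\<close>
definition energy :: "(real \<Rightarrow> real) \<Rightarrow> nat \<Rightarrow> (nat \<Rightarrow> real) \<Rightarrow> real" where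
  "energy \<phi> n x =
     (\<Sum>j=1..n. \<Sum>k\<in>{1..n} - {j}. charge_potential (x k) (x j)) + 2 * (\<Sum>j=1..n. \<phi> (x j))"

definition admissible :: "real \<Rightarrow> real \<Rightarrow> nat \<Rightarrow> (nat \<Rightarrow> real) \<Rightarrow> bool" where
  "admissible \<alpha> \<beta> n x \<longleftrightarrow>
     (\<forall>j\<in>{1..n}. \<alpha> < x j \<and> x j < \<beta>) \<and>
     (\<forall>j\<in>{1..n}. \<forall>k\<in>{1..n}. j \<noteq> k \<longrightarrow> \<bar>x j - x k\<bar> > 1)"

definition equilibrium_distribution ::
  "(real \<Rightarrow> real) \<Rightarrow> real \<Rightarrow> real \<Rightarrow> nat \<Rightarrow> (nat \<Rightarrow> real) \<Rightarrow> bool" where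
  "equilibrium_distribution \<phi> \<alpha> \<beta> n x \<longleftrightarrow>
     (\<forall>j\<in>{1..n}. \<alpha> < x j \<and> x j < \<beta>) \<and>
     (\<forall>j\<in>{1..<n}. x (Suc j) > x j + 1) \<and>
     (\<forall>y. admissible \<alpha> \<beta> n y \<longrightarrow> energy \<phi> n x \<le> energy \<phi> n y)"

text \<open>A force determines its external field only up to an additive constant.
  The primitive below shows that a field with the Krawtchouk force exists.\<close>
definition krawtchouk_force :: "real \<Rightarrow> nat \<Rightarrow> real \<Rightarrow> real" where
  "krawtchouk_force p N x = 1 / 2 * ln (p * (real N - x) / ((1 - p) * x))"

lemma krawtchouk_field_exists:
  assumes "0 < p" "p < 1" "0 < x" "x < real N"
  shows "((\<lambda>x. 1 / 2 * ((real N - x) * ln (real N - x) + x * ln x - x * ln (p / (1 - p))))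
           has_real_derivative - krawtchouk_force p N x) (at x)"
proof -
  have "ln (p * (real N - x) / ((1 - p) * x)) = ln (p / (1 - p)) + ln (real N - x) - ln x"
    using assms by (simp add: ln_div ln_mult)
  then have eq: "1 / 2 * (- 1 * ln (real N - x) - 1 + (ln x + 1) - ln (p / (1 - p)))
      = - krawtchouk_force p N x"
    by (simp add: krawtchouk_force_def algebra_simps)
  have "((\<lambda>x. (real N - x) * ln (real N - x)) has_real_derivative - 1 * ln (real N - x) - 1) (at x)"
    "((\<lambda>x. x * ln x) has_real_derivative ln x + 1) (at x)"
    "((\<lambda>x. x * ln (p / (1 - p))) has_real_derivative ln (p / (1 - p))) (at x)"
    using assms by (auto intro!: derivative_eq_intros)
  from DERIV_cmult[OF DERIV_diff[OF DERIV_add[OF this(1,2)] this(3)], of "1 / 2"] eq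
  show ?thesis
    by simp
qed

end

theory Submission
  imports Defs
begin

text \<open>Everything rests on three contiguity relations. The backward shift expresses the polynomial of
  degree \<open>n + 1\<close> for \<open>N + 1\<close> through that of degree \<open>n\<close> for \<open>N\<close> at \<open>x\<close> and \<open>x - 1\<close>, and sign changes
  carry real zeros with gaps greater than 1 from one to the other. Together with the forward shift
  it gives the difference equation, whose logarithm at a zero says that the total force on the
  charge there vanishes; since the energy is strictly convex on ordered configurations, this
  critical point is the unique minimizer. The third relation writes the polynomial for \<open>N\<close> as a convex
  combination, up to a positive factor, of the polynomial for \<open>N + 1\<close> at \<open>x\<close> and \<open>x + 1\<close>, which
  yields the monotonicity in \<open>N\<close>.\<close>

section \<open>Contiguity relations\<close>

text \<open>In the basis \<open>pochhammer (- x) k\<close> shifts of \<open>x\<close> act by moving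
  the index, so each contiguity relation becomes an identity between these coefficients.\<close>

definition krawtchouk_coeff :: "nat \<Rightarrow> real \<Rightarrow> nat \<Rightarrow> nat \<Rightarrow> real" where
  "krawtchouk_coeff n p N k =
     pochhammer (- real n) k / (fact k * pochhammer (- real N) k) * (1 / p) ^ k"

lemma poly_krawtchouk_coeff:
  "poly (krawtchouk n p N) x = (\<Sum>k\<le>n. krawtchouk_coeff n p N k * pochhammer (- x) k)"
  by (simp add: poly_krawtchouk krawtchouk_coeff_def atMost_atLeast0 mult_ac)

lemma krawtchouk_coeff_0 [simp]: "krawtchouk_coeff n p N 0 = 1"
  by (simp add: krawtchouk_coeff_def)

lemma krawtchouk_coeff_eq_0 [simp]: "n < k \<Longrightarrow> krawtchouk_coeff n p N k = 0"
  by (simp add: krawtchouk_coeff_def pochhammer_of_nat_eq_0_iff)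

text \<open>The first factors of both Pochhammer symbols split off and their signs cancel. For
  \<open>k > N\<close> both sides are 0, since division by zero yields 0.\<close>

lemma krawtchouk_coeff_Suc_Suc_Suc:
  "krawtchouk_coeff (Suc n) p (Suc N) (Suc k)
     = real (Suc n) / (real (Suc N) * real (Suc k) * p) * krawtchouk_coeff n p N k"
proof -
  have "pochhammer (- real (Suc m)) (Suc k) = - (real (Suc m) * pochhammer (- real m) k)" for m
    by (simp add: pochhammer_rec algebra_simps)
  then show ?thesis
    unfolding krawtchouk_coeff_def fact_Suc power_Suc by (simp add: mult_ac del: of_nat_Suc)
qed

lemma krawtchouk_coeff_Suc_index:
  assumes "n \<le> N" "k \<le> n" "p \<noteq> 0"
  shows "p * (real N - real k) * krawtchouk_coeff n p N (Suc k)
     = (real n - real k) / real (Suc k) * krawtchouk_coeff n p N k"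
proof (cases "k = N")
  case True
  \<comment> \<open>Now \<open>k \<le> n \<le> N = k\<close> forces \<open>n = k\<close>, so both
    sides carry a zero factor. The case is separate because the denominator of coefficient
    \<open>Suc k\<close> is then 0.\<close>
  with assms show ?thesis by simp
next
  case False
  with assms have "real N - real k \<noteq> 0" "pochhammer (- real N) k \<noteq> 0"
    by (auto simp: pochhammer_of_nat_eq_0_iff)
  moreover have "pochhammer (- real m) (Suc k) = - (real m - real k) * pochhammer (- real m) k" for m
    by (simp add: pochhammer_rec')
  ultimately show ?thesis
    using \<open>p \<noteq> 0\<close> unfolding krawtchouk_coeff_def fact_Suc
    by (simp add: divide_simps del: of_nat_Suc) (auto simp: algebra_simps)
qed

text \<open>Both sides come from \<open>pochhammer (- real (Suc m)) (Suc k)\<close>, once with its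
  first and once with its last factor split off.\<close>

lemma pochhammer_Suc_real:
  "real (Suc m) * pochhammer (- real m) k = (real (Suc m) - real k) * pochhammer (- real (Suc m)) k"
  using pochhammer_rec[of "- real (Suc m)" k] pochhammer_rec'[of "- real (Suc m)" k]
  by (simp add: algebra_simps)

lemma krawtchouk_coeff_Suc_degree:
  "real (Suc n) * krawtchouk_coeff n p N k
     = (real (Suc n) - real k) * krawtchouk_coeff (Suc n) p N k"
  using pochhammer_Suc_real[of n k] unfolding krawtchouk_coeff_def
  by (metis (no_types, lifting) mult.assoc times_divide_eq_right)

lemma krawtchouk_coeff_Suc_N:
  assumes "k \<le> N"
  shows "real (Suc N) * krawtchouk_coeff n p (Suc N) k
     = (real (Suc N) - real k) * krawtchouk_coeff n p N k"
proof -
  have "pochhammer (- real N) k \<noteq> 0" "pochhammer (- real (Suc N)) k \<noteq> 0"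
    using assms by (auto simp: pochhammer_of_nat_eq_0_iff simp del: of_nat_Suc)
  with pochhammer_Suc_real[of N k] show ?thesis
    unfolding krawtchouk_coeff_def by (simp add: divide_simps del: of_nat_Suc)
qed

text \<open>The unit difference of \<open>pochhammer (- x) (Suc k)\<close> is
  \<open>- real (Suc k) * pochhammer (- x) k\<close>: differencing lowers the index, and the
  coefficients lower \<open>n\<close> and \<open>N\<close> with it.\<close>

lemma krawtchouk_forward_shift:
  assumes "p \<noteq> 0"
  shows "poly (krawtchouk (Suc n) p (Suc N)) (x + 1) - poly (krawtchouk (Suc n) p (Suc N)) x
     = - (real (Suc n) / (p * real (Suc N)) * poly (krawtchouk n p N) x)"
proof -
  have shift: "pochhammer (- (x + 1)) (Suc k) - pochhammer (- x) (Suc k)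
      = - real (Suc k) * pochhammer (- x) k" for k
    using pochhammer_rec[of "- (x + 1)" k] pochhammer_rec'[of "- x" k]
    by (simp add: algebra_simps)
  have "poly (krawtchouk (Suc n) p (Suc N)) (x + 1) - poly (krawtchouk (Suc n) p (Suc N)) x
     = (\<Sum>k\<le>n. krawtchouk_coeff (Suc n) p (Suc N) (Suc k)
          * (pochhammer (- (x + 1)) (Suc k) - pochhammer (- x) (Suc k)))"
    unfolding poly_krawtchouk_coeff sum.atMost_Suc_shift
    by (simp add: sum_subtractf right_diff_distrib)
  also have "\<dots> = (\<Sum>k\<le>n. - (real (Suc n) / (p * real (Suc N)))
      * (krawtchouk_coeff n p N k * pochhammer (- x) k))"
    unfolding shift krawtchouk_coeff_Suc_Suc_Suc using assms
    by (intro sum.cong) (simp_all add: divide_simps del: of_nat_Suc)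
  finally show ?thesis
    unfolding poly_krawtchouk_coeff by (simp add: sum_distrib_left sum_negf del: of_nat_Suc)
qed

text \<open>Multiplication by \<open>x\<close> acts on the basis through the two rules
  \<open>u\<close>. The contributions to \<open>pochhammer (- x) (Suc k)\<close> carry the weights
  \<open>p\<close> and \<open>1 - p\<close>, so they add up to plain \<open>?a k\<close>.\<close>

lemma krawtchouk_backward_shift:
  assumes "p \<noteq> 0" "n \<le> N"
  shows "real (Suc N) * p * poly (krawtchouk (Suc n) p (Suc N)) x
     = p * (real (Suc N) - x) * poly (krawtchouk n p N) x
       - (1 - p) * x * poly (krawtchouk n p N) (x - 1)"
proof -
  let ?a = "krawtchouk_coeff n p N" and ?u = "pochhammer (- x)"
  have u: "x * pochhammer (- (x - 1)) k = - ?u (Suc k)" "x * ?u k = real k * ?u k - ?u (Suc k)" for k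
    using pochhammer_rec[of "- x" k] pochhammer_rec'[of "- x" k] by (simp_all add: algebra_simps)
  have "p * (real (Suc N) - x) * poly (krawtchouk n p N) x
       - (1 - p) * x * poly (krawtchouk n p N) (x - 1)
     = (\<Sum>k\<le>n. ?a k * (p * real (Suc N) * ?u k - p * (x * ?u k)
         - (1 - p) * (x * pochhammer (- (x - 1)) k)))"
    unfolding poly_krawtchouk_coeff sum_distrib_left sum_subtractf[symmetric]
    by (intro sum.cong) (simp_all add: algebra_simps)
  also have "\<dots> = (\<Sum>k\<le>n. p * (real (Suc N) - real k) * ?a k * ?u k + ?a k * ?u (Suc k))"
    unfolding u by (intro sum.cong) (simp_all add: algebra_simps)
  \<comment> \<open>The added term is 0 because coefficient \<open>Suc n\<close> vanishes; after the
    index shift both sums run over the same basis elements.\<close>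
  also have "\<dots> = (\<Sum>k\<le>Suc n. p * (real (Suc N) - real k) * ?a k * ?u k)
      + (\<Sum>k\<le>n. ?a k * ?u (Suc k))"
    by (simp add: sum.distrib)
  also have "\<dots> = p * real (Suc N)
      + (\<Sum>k\<le>n. (p * (real N - real k) * ?a (Suc k) + ?a k) * ?u (Suc k))"
    unfolding sum.atMost_Suc_shift by (simp add: sum.distrib distrib_right)
  also have "\<dots> = p * real (Suc N) + (\<Sum>k\<le>n. real (Suc N) * p
      * (krawtchouk_coeff (Suc n) p (Suc N) (Suc k) * ?u (Suc k)))"
  proof -
    \<comment> \<open>The ratio of consecutive coefficients turns the left side into
      \<open>?a k\<close> times \<open>(n - k) / (k + 1) + 1\<close>, that is
      \<open>(n + 1) / (k + 1)\<close>.\<close>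
    have "p * (real N - real k) * ?a (Suc k) + ?a k
        = real (Suc N) * p * krawtchouk_coeff (Suc n) p (Suc N) (Suc k)" if "k \<le> n" for k
      using krawtchouk_coeff_Suc_index[OF assms(2) that assms(1)] assms(1)
      unfolding krawtchouk_coeff_Suc_Suc_Suc by (simp add: divide_simps) (simp add: algebra_simps)
    then show ?thesis
      by (intro arg_cong2[of _ _ _ _ "(+)"] sum.cong) (simp_all only: atMost_iff mult.assoc)
  qed
  also have "\<dots> = real (Suc N) * p * poly (krawtchouk (Suc n) p (Suc N)) x"
    unfolding poly_krawtchouk_coeff sum.atMost_Suc_shift
    by (simp add: algebra_simps sum_distrib_left)
  finally show ?thesis ..
qed

text \<open>The forward shift at \<open>x\<close> and \<open>x - 1\<close> writes both differences
  through degree \<open>n - 1\<close> and parameter \<open>N - 1\<close>; what remains is the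
  right-hand side of the backward shift.\<close>

lemma krawtchouk_difference_equation:
  assumes "p \<noteq> 0" "n \<le> N"
  shows "p * (real N - x) * (poly (krawtchouk n p N) (x + 1) - poly (krawtchouk n p N) x)
     + (1 - p) * x * (poly (krawtchouk n p N) (x - 1) - poly (krawtchouk n p N) x)
     = - (real n * poly (krawtchouk n p N) x)"
proof (cases n)
  case 0
  then show ?thesis by (simp add: poly_krawtchouk)
next
  case (Suc m)
  then obtain M where M: "N = Suc M" "m \<le> M"
    using assms by (cases N) auto
  define a where "a = real (Suc m) / (p * real (Suc M))"
  let ?K = "poly (krawtchouk m p M)"
  have diff: "poly (krawtchouk n p N) (x + 1) - poly (krawtchouk n p N) x = - (a * ?K x)"
    "poly (krawtchouk n p N) (x - 1) - poly (krawtchouk n p N) x = a * ?K (x - 1)"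
    using krawtchouk_forward_shift[OF assms(1), of m M x]
      krawtchouk_forward_shift[OF assms(1), of m M "x - 1"]
    unfolding a_def M(1) Suc by auto
  have "p * (real N - x) * (- (a * ?K x)) + (1 - p) * x * (a * ?K (x - 1))
      = - a * (p * (real N - x) * ?K x - (1 - p) * x * ?K (x - 1))"
    by (simp add: algebra_simps)
  also have "\<dots> = - a * (real (Suc M) * p * poly (krawtchouk n p N) x)"
    unfolding M(1) Suc krawtchouk_backward_shift[OF assms(1) M(2)] ..
  also have "\<dots> = - (real n * poly (krawtchouk n p N) x)"
    using assms(1) Suc by (simp add: a_def del: of_nat_Suc)
  finally show ?thesis
    unfolding diff .
qed

text \<open>The right side is the value at \<open>x\<close> plus \<open>p\<close> times the forward
  difference, which the forward shift evaluates. Comparing coefficients leaves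
  \<open>(N + 1 - k) - (n - k) = N + 1 - n\<close>.\<close>

lemma krawtchouk_average:
  assumes "p \<noteq> 0" "1 \<le> n" "n \<le> N"
  shows "(real (Suc N) - real n) / real (Suc N) * poly (krawtchouk n p N) x
     = (1 - p) * poly (krawtchouk n p (Suc N)) x + p * poly (krawtchouk n p (Suc N)) (x + 1)"
proof -
  obtain m where m: "n = Suc m" using assms by (cases n) auto
  have "(1 - p) * poly (krawtchouk n p (Suc N)) x + p * poly (krawtchouk n p (Suc N)) (x + 1)
     = poly (krawtchouk n p (Suc N)) x
       + p * (poly (krawtchouk n p (Suc N)) (x + 1) - poly (krawtchouk n p (Suc N)) x)"
    by (simp add: algebra_simps)
  also have "\<dots> = poly (krawtchouk n p (Suc N)) x - real n / real (Suc N) * poly (krawtchouk m p N) x"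
    unfolding m krawtchouk_forward_shift[OF assms(1)] using assms(1) by simp
  \<comment> \<open>The sum is padded to \<open>k \<le> n\<close> with a vanishing coefficient so
    that the two sums combine termwise.\<close>
  also have "poly (krawtchouk m p N) x = (\<Sum>k\<le>n. krawtchouk_coeff m p N k * pochhammer (- x) k)"
    unfolding poly_krawtchouk_coeff m by simp
  also have "poly (krawtchouk n p (Suc N)) x - real n / real (Suc N) * \<dots>
     = (\<Sum>k\<le>n. (krawtchouk_coeff n p (Suc N) k - real n / real (Suc N) * krawtchouk_coeff m p N k)
          * pochhammer (- x) k)"
    unfolding poly_krawtchouk_coeff sum_distrib_left sum_subtractf[symmetric]
    by (intro sum.cong) (simp_all add: algebra_simps)
  also have "\<dots> = (\<Sum>k\<le>n. (real (Suc N) - real n) / real (Suc N)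
      * (krawtchouk_coeff n p N k * pochhammer (- x) k))"
  proof (intro sum.cong refl)
    fix k assume "k \<in> {..n}"
    with assms have "k \<le> N" by simp
    have "real (Suc N) * (krawtchouk_coeff n p (Suc N) k
        - real n / real (Suc N) * krawtchouk_coeff m p N k)
      = real (Suc N) * krawtchouk_coeff n p (Suc N) k - real n * krawtchouk_coeff m p N k"
      by (simp add: algebra_simps del: of_nat_Suc)
    also have "\<dots> = (real (Suc N) - real n) * krawtchouk_coeff n p N k"
      unfolding krawtchouk_coeff_Suc_N[OF \<open>k \<le> N\<close>]
      using krawtchouk_coeff_Suc_degree[of m p N k] m by (simp add: algebra_simps)
    finally have eq: "krawtchouk_coeff n p (Suc N) k - real n / real (Suc N) * krawtchouk_coeff m p N k
        = (real (Suc N) - real n) * krawtchouk_coeff n p N k / real (Suc N)"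
      by (simp add: eq_divide_eq mult.commute del: of_nat_Suc)
    show "(krawtchouk_coeff n p (Suc N) k - real n / real (Suc N) * krawtchouk_coeff m p N k)
          * pochhammer (- x) k = (real (Suc N) - real n) / real (Suc N)
      * (krawtchouk_coeff n p N k * pochhammer (- x) k)"
      unfolding eq by simp
  qed
  finally show ?thesis
    unfolding poly_krawtchouk_coeff by (simp add: sum_distrib_left)
qed

lemma poly_krawtchouk_at_0: "poly (krawtchouk n p N) 0 = 1"
  by (simp add: poly_krawtchouk_coeff pochhammer_0_left if_distrib cong: if_cong)

lemma degree_krawtchouk_le: "degree (krawtchouk n p N) \<le> n"
proof -
  have "degree (pochhammer (- [:0, 1::real:]) k) \<le> k" for k
  proof (induction k)
    case (Suc k)
    have "degree (- [:0, 1::real:] + of_nat k) \<le> 1"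
      by (intro degree_add_le) auto
    with Suc show ?case
      unfolding pochhammer_Suc by (intro order.trans[OF degree_mult_le]) simp
  qed simp
  then show ?thesis
    unfolding krawtchouk_def
    by (intro degree_sum_le) (auto intro: order.trans[OF degree_smult_le] order.trans)
qed

section \<open>Zeros\<close>

text \<open>The difference of the two sides has degree at most \<open>n\<close> but vanishes at the
  \<open>n + 1\<close> points 0 and \<open>w j\<close>. Fixing the value at 0 takes the place of
  knowing the leading coefficient.\<close>

lemma poly_eq_prod_roots:
  fixes q :: "real poly"
  assumes "degree q \<le> n" "poly q 0 = 1" "inj_on w {1..n}"
    and roots: "\<And>j. j \<in> {1..n} \<Longrightarrow> poly q (w j) = 0"
  shows "q = (\<Prod>j=1..n. [:1, - 1 / w j:])"
proof -
  have nz: "w j \<noteq> 0" if "j \<in> {1..n}" for j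
    using roots[OF that] assms(2) by auto
  let ?r = "\<Prod>j=1..n. [:1, - 1 / w j:]"
  define d where "d = q - ?r"
  have "degree ?r \<le> (\<Sum>j=1..n. 1)"
    by (rule order.trans[OF degree_prod_sum_le]) (simp_all del: sum_constant add: sum_mono)
  then have deg: "degree d \<le> n"
    unfolding d_def using assms(1) by (intro degree_diff_le) auto
  have d0: "poly d 0 = 0"
    by (simp add: d_def assms(2) poly_prod)
  have dw: "poly d (w j) = 0" if "j \<in> {1..n}" for j
    using that nz[OF that] roots[OF that] by (auto simp: d_def poly_prod prod_zero_iff intro!: bexI[of _ j])
  have "d = 0"
  proof (rule ccontr)
    assume "d \<noteq> 0"
    have "Suc n = card (insert 0 (w ` {1..n}))"
      using nz assms(3) by (subst card_insert_disjoint) (auto simp: card_image)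
    also have "\<dots> \<le> card {x. poly d x = 0}"
      using \<open>d \<noteq> 0\<close> d0 dw by (intro card_mono poly_roots_finite) auto
    also have "\<dots> \<le> degree d"
      using \<open>d \<noteq> 0\<close> by (rule card_poly_roots_bound)
    finally show False using deg by simp
  qed
  then show ?thesis by (simp add: d_def)
qed

lemma poly_prod_roots:
  fixes w :: "nat \<Rightarrow> real"
  shows "poly (\<Prod>j=1..n. [:1, - 1 / w j:]) y = (\<Prod>j=1..n. 1 - y / w j)"
  by (simp add: poly_prod)

text \<open>Since \<open>w i\<close> is positive, the factor \<open>1 - y / w i\<close> is negative
  exactly when \<open>w i\<close> lies below \<open>y\<close>; \<open>j\<close> counts these
  factors.\<close>

lemma sgn_prod_roots:
  fixes w :: "nat \<Rightarrow> real"
  assumes "\<And>i. i \<in> {1..n} \<Longrightarrow> 0 < w i" "j \<le> n"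
    and "\<And>i. i \<in> {1..j} \<Longrightarrow> w i < y" "\<And>i. i \<in> {Suc j..n} \<Longrightarrow> y < w i"
  shows "sgn (poly (\<Prod>j=1..n. [:1, - 1 / w j:]) y) = (- 1) ^ j"
proof -
  have "{1..n} = {1..j} \<union> {Suc j..n}" using \<open>j \<le> n\<close> by auto
  then have "poly (\<Prod>j=1..n. [:1, - 1 / w j:]) y
      = (\<Prod>i=1..j. 1 - y / w i) * (\<Prod>i=Suc j..n. 1 - y / w i)"
    unfolding poly_prod_roots by (simp add: prod.union_disjoint)
  moreover have "(\<Prod>i=Suc j..n. 1 - y / w i) > 0"
    using assms by (intro prod_pos) (auto simp: divide_simps)
  moreover have "(\<Prod>i=1..j. 1 - y / w i) = (- 1) ^ j * (\<Prod>i=1..j. y / w i - 1)"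
    using prod.distrib[of "\<lambda>_. - 1" "\<lambda>i. y / w i - 1" "{1..j}"] by simp
  moreover have "(\<Prod>i=1..j. y / w i - 1) > 0"
  proof (intro prod_pos)
    fix i assume "i \<in> {1..j}"
    then show "y / w i - 1 > 0"
      using assms(1)[of i] assms(2,3) by simp
  qed
  ultimately show ?thesis
    by (cases "even j") (simp_all add: sgn_mult)
qed

lemma sgn_eq_of_pos_multiples:
  fixes x y :: real
  assumes "a * x = b * y" "0 < a" "0 < b"
  shows "sgn x = sgn y"
  using arg_cong[OF assms(1), of sgn] assms(2,3) by (simp add: sgn_mult)

lemma gap_mono:
  fixes x :: "nat \<Rightarrow> real"
  assumes "\<And>j. m \<le> j \<Longrightarrow> j < n \<Longrightarrow> x j + 1 < x (Suc j)" "m \<le> i" "i < j" "j \<le> n"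
  shows "x i + 1 < x j"
  using assms(3,4)
proof (induction j)
  case (Suc j)
  then show ?case
    using assms(1)[of j] assms(2) by (cases "i = j") auto
qed simp

lemma poly_root_between:
  fixes q :: "real poly"
  assumes "a < b" "sgn (poly q a) = - sgn (poly q b)" "poly q a \<noteq> 0"
  shows "\<exists>w. a < w \<and> w < b \<and> poly q w = 0"
proof -
  have "poly q a * poly q b < 0"
    using assms(2,3) by (auto simp: sgn_if mult_less_0_iff split: if_splits)
  then show ?thesis
    using poly_IVT[OF assms(1), of q] by blast
qed

text \<open>The factorization, stronger than the vanishing at each \<open>x j\<close>, records that
  the list is complete and makes the signs between zeros readable. At \<open>n = 0\<close> it still
  makes sense and starts an induction.\<close>

definition krawtchouk_zeros :: "nat \<Rightarrow> real \<Rightarrow> nat \<Rightarrow> (nat \<Rightarrow> real) \<Rightarrow> bool" where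
  "krawtchouk_zeros n p N x \<longleftrightarrow>
     (\<forall>j\<in>{1..n}. 0 < x j \<and> x j < real N) \<and>
     (\<forall>j\<in>{1..<n}. x j + 1 < x (Suc j)) \<and>
     krawtchouk n p N = (\<Prod>j=1..n. [:1, - 1 / x j:])"

lemma krawtchouk_zerosD:
  assumes "krawtchouk_zeros n p N x"
  shows "j \<in> {1..n} \<Longrightarrow> 0 < x j" "j \<in> {1..n} \<Longrightarrow> x j < real N"
    and "1 \<le> i \<Longrightarrow> i < j \<Longrightarrow> j \<le> n \<Longrightarrow> x i + 1 < x j"
    and "krawtchouk n p N = (\<Prod>j=1..n. [:1, - 1 / x j:])"
    and "j \<in> {1..n} \<Longrightarrow> poly (krawtchouk n p N) (x j) = 0"
proof -
  show gap: "1 \<le> i \<Longrightarrow> i < j \<Longrightarrow> j \<le> n \<Longrightarrow> x i + 1 < x j"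
    using assms by (intro gap_mono[of 1 n x i j]) (auto simp: krawtchouk_zeros_def)
  show pos: "j \<in> {1..n} \<Longrightarrow> 0 < x j" "j \<in> {1..n} \<Longrightarrow> x j < real N"
    and eq: "krawtchouk n p N = (\<Prod>j=1..n. [:1, - 1 / x j:])"
    using assms by (auto simp: krawtchouk_zeros_def)
  show "poly (krawtchouk n p N) (x j) = 0" if "j \<in> {1..n}"
    unfolding eq poly_prod_roots using that pos(1)[OF that]
    by (auto simp: prod_zero_iff intro!: bexI[of _ j])
qed

lemma krawtchouk_zeros_sgn:
  assumes "krawtchouk_zeros n p N x" "j \<le> n"
    and "\<And>i. i \<in> {1..j} \<Longrightarrow> x i < y" "\<And>i. i \<in> {Suc j..n} \<Longrightarrow> y < x i"
  shows "sgn (poly (krawtchouk n p N) y) = (- 1) ^ j"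
  unfolding krawtchouk_zerosD(4)[OF assms(1)]
  by (rule sgn_prod_roots) (use assms krawtchouk_zerosD(1)[OF assms(1)] in auto)

text \<open>The gaps make the points distinct; degree at most \<open>n\<close> and value 1 at 0 then
  force the factorization.\<close>

lemma krawtchouk_zerosI:
  assumes "\<And>j. j \<in> {1..n} \<Longrightarrow> poly (krawtchouk n p N) (x j) = 0"
    and "\<And>j. j \<in> {1..n} \<Longrightarrow> 0 < x j" "\<And>j. j \<in> {1..n} \<Longrightarrow> x j < real N"
    and gap: "\<And>j. 1 \<le> j \<Longrightarrow> j < n \<Longrightarrow> x j + 1 < x (Suc j)"
  shows "krawtchouk_zeros n p N x"
proof -
  have "inj_on x {1..n}"
  proof (rule linorder_inj_onI')
    fix i j assume "i \<in> {1..n}" "j \<in> {1..n}" "i < j"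
    then show "x i \<noteq> x j" using gap_mono[of 1 n x i j] gap by fastforce
  qed
  then show ?thesis
    unfolding krawtchouk_zeros_def
    using poly_eq_prod_roots[OF degree_krawtchouk_le poly_krawtchouk_at_0] assms by auto
qed

text \<open>At the points \<open>x j\<close> and \<open>x j + 1\<close> one of the two terms of the backward shift vanishes and
  the other has a known sign, so every zero of the next polynomial lies between \<open>x (j - 1) + 1\<close>
  and \<open>x j\<close>; this is what forces the new zeros apart by more than 1.\<close>

lemma krawtchouk_zeros_Suc:
  assumes p: "0 < p" "p < 1" and "n \<le> N" and x: "krawtchouk_zeros n p N x"
  shows "\<exists>w. krawtchouk_zeros (Suc n) p (Suc N) w"
proof -
  \<comment> \<open>The artificial end values make \<open>X 0 + 1 = 0\<close> and
    \<open>X (Suc n) = N + 1\<close> the two points where a linear factor of the backward shift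
    vanishes, while all gaps stay greater than 1.\<close>
  define X where "X j = (if j = 0 then - 1 else if j = Suc n then real (Suc N) else x j)" for j
  let ?K = "poly (krawtchouk n p N)" and ?Q = "poly (krawtchouk (Suc n) p (Suc N))"
  have Xin: "X j = x j" if "j \<in> {1..n}" for j
    using that by (auto simp: X_def)
  have Xgap1: "X j + 1 < X (Suc j)" if "j \<le> n" for j
    using that krawtchouk_zerosD(1,2)[OF x, of j] krawtchouk_zerosD(1,2)[OF x, of "Suc j"]
      krawtchouk_zerosD(3)[OF x, of j "Suc j"]
    by (auto simp: X_def)
  have Xgap: "X i + 1 < X j" if "i < j" "j \<le> Suc n" for i j
    by (rule gap_mono[of 0 "Suc n"]) (use that Xgap1 in auto)
  have B: "real (Suc N) * p * ?Q y
      = p * (real (Suc N) - y) * ?K y - (1 - p) * y * ?K (y - 1)" for y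
    using krawtchouk_backward_shift[of p n N y] p \<open>n \<le> N\<close> by simp
  have left: "sgn (?Q (X j + 1)) = (- 1) ^ j" if "j \<le> n" for j
  proof -
    have less: "X j < real N"
      using krawtchouk_zerosD(2)[OF x, of j] that by (auto simp: X_def)
    \<comment> \<open>At \<open>j = 0\<close> the factor \<open>y\<close> removes the second term of
      \<open>B\<close>; at \<open>j > 0\<close> the zero \<open>x j\<close> of \<open>?K\<close>
      does.\<close>
    have "X j + 1 = 0 \<or> ?K (X j) = 0"
      using krawtchouk_zerosD(5)[OF x, of j] that by (auto simp: X_def)
    then have eq: "real (Suc N) * p * ?Q (X j + 1) = p * (real (Suc N) - (X j + 1)) * ?K (X j + 1)"
      unfolding B by auto
    have "sgn (?K (X j + 1)) = (- 1) ^ j"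
    proof (rule krawtchouk_zeros_sgn[OF x that])
      fix i assume i: "i \<in> {1..j}"
      then have "X i \<le> X j"
        using Xgap[of i j] that by (cases "i = j") auto
      then show "x i < X j + 1"
        using Xin[of i] i that by auto
    next
      fix i assume "i \<in> {Suc j..n}"
      then show "X j + 1 < x i"
        using Xgap[of j i] Xin[of i] by auto
    qed
    with sgn_eq_of_pos_multiples[OF eq] less p show ?thesis
      by simp
  qed
  have right: "sgn (?Q (X (Suc j))) = - ((- 1) ^ j)" if "j \<le> n" for j
  proof -
    have pos: "0 < X (Suc j)"
      using Xgap[of 0 "Suc j"] that by (simp add: X_def)
    \<comment> \<open>Here the first term of \<open>B\<close> vanishes, through its linear factor at
      \<open>j = n\<close> and through a zero of \<open>?K\<close> otherwise.\<close>
    have "real (Suc N) - X (Suc j) = 0 \<or> ?K (X (Suc j)) = 0"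
      using krawtchouk_zerosD(5)[OF x, of "Suc j"] that by (auto simp: X_def)
    then have eq: "real (Suc N) * p * ?Q (X (Suc j)) = (1 - p) * X (Suc j) * - ?K (X (Suc j) - 1)"
      unfolding B by auto
    have "sgn (?K (X (Suc j) - 1)) = (- 1) ^ j"
    proof (rule krawtchouk_zeros_sgn[OF x that])
      fix i assume "i \<in> {1..j}"
      then show "x i < X (Suc j) - 1"
        using Xgap[of i "Suc j"] Xin[of i] that by auto
    next
      fix i assume i: "i \<in> {Suc j..n}"
      then have "X (Suc j) \<le> X i"
        using Xgap[of "Suc j" i] by (cases "i = Suc j") auto
      then show "X (Suc j) - 1 < x i"
        using Xin[of i] i by auto
    qed
    with sgn_eq_of_pos_multiples[OF eq] pos p show ?thesis
      by (simp add: sgn_minus)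
  qed
  have "\<exists>w. X j + 1 < w \<and> w < X (Suc j) \<and> ?Q w = 0" if "j \<le> n" for j
    by (rule poly_root_between[of "X j + 1" "X (Suc j)" "krawtchouk (Suc n) p (Suc N)"])
      (use Xgap1[OF that] left[OF that] right[OF that] in auto)
  then have "\<forall>j. \<exists>w. j \<le> n \<longrightarrow> X j + 1 < w \<and> w < X (Suc j) \<and> ?Q w = 0"
    by blast
  from choice[OF this] obtain w
    where w: "\<And>j. j \<le> n \<Longrightarrow> X j + 1 < w j \<and> w j < X (Suc j) \<and> ?Q (w j) = 0"
    by blast
  \<comment> \<open>The intervals are counted from 0 and the zeros from 1, hence the shift of the
    index.\<close>
  have "krawtchouk_zeros (Suc n) p (Suc N) (\<lambda>j. w (j - 1))"
  proof (rule krawtchouk_zerosI)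
    fix j assume j: "j \<in> {1..Suc n}"
    then have jn: "j - 1 \<le> Suc n" by auto
    from j have wj: "X (j - 1) + 1 < w (j - 1)" "w (j - 1) < X j" "?Q (w (j - 1)) = 0"
      using w[of "j - 1"] by auto
    then show "?Q (w (j - 1)) = 0" by simp
    show "0 < w (j - 1)"
      using wj(1) Xgap[of 0 "j - 1"] j jn by (cases "j = 1") (auto simp: X_def[of 0])
    show "w (j - 1) < real (Suc N)"
      using wj(2) Xgap[of j "Suc n"] j by (cases "j = Suc n") (auto simp: X_def[of "Suc n"])
  next
    fix j assume "1 \<le> j" "j < Suc n"
    then have "j - 1 \<le> n" "j \<le> n" "Suc (j - 1) = j" by auto
    \<comment> \<open>The point \<open>X j\<close> separates the two zeros:
      \<open>w (j - 1) < X j\<close> and \<open>X j + 1 < w j\<close>.\<close>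
    then show "w (j - 1) + 1 < w (Suc j - 1)"
      using w[of "j - 1"] w[of j] by auto
  qed
  then show ?thesis by blast
qed

text \<open>The induction lowers \<open>n\<close> and \<open>N\<close> together and ends at degree 0
  with parameter \<open>N - n\<close>.\<close>

lemma krawtchouk_zeros_exist:
  assumes "0 < p" "p < 1" "n \<le> N"
  shows "\<exists>x. krawtchouk_zeros n p N x"
  using \<open>n \<le> N\<close>
proof (induction n arbitrary: N)
  case 0
  have "krawtchouk 0 p N = 1"
    by (simp add: krawtchouk_def)
  then show ?case by (simp add: krawtchouk_zeros_def)
next
  case (Suc n)
  then obtain M where "N = Suc M" "n \<le> M" by (cases N) auto
  with Suc.IH[of M] krawtchouk_zeros_Suc[OF assms(1,2)] show ?case by blast
qed

section \<open>Zeros as a sorted list\<close>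

lemma krawtchouk_zeros_set:
  assumes "krawtchouk_zeros n p N x"
  shows "{y. poly (krawtchouk n p N) y = 0} = x ` {1..n}"
proof -
  have "x j \<noteq> 0" if "j \<in> {1..n}" for j
    using krawtchouk_zerosD(1)[OF assms that] by simp
  then show ?thesis
    unfolding krawtchouk_zerosD(4)[OF assms] poly_prod_roots
    by (auto simp: prod_zero_iff)
qed

lemma krawtchouk_zeros_strict_mono:
  assumes "krawtchouk_zeros n p N x"
  shows "strict_mono_on {1..n} x"
proof (rule strict_mono_onI)
  fix i j assume "i \<in> {1..n}" "j \<in> {1..n}" "i < j"
  then show "x i < x j"
    using krawtchouk_zerosD(3)[OF assms, of i j] by auto
qed

lemma sorted_list_of_set_image:
  assumes "strict_mono_on {1..n} x" "j \<in> {1..n}"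
  shows "sorted_list_of_set (x ` {1..n}) ! (j - 1) = (x j :: real)"
proof -
  have "sorted_wrt (<) (map x [1..<Suc n])"
    using assms(1) by (auto simp: sorted_wrt_iff_nth_less strict_mono_on_def simp del: upt_Suc)
  then have "sorted_list_of_set (set (map x [1..<Suc n])) = map x [1..<Suc n]"
    by (intro sorted_list_of_set.idem_if_sorted_distinct) (auto simp: strict_sorted_iff)
  moreover have "set (map x [1..<Suc n]) = x ` {1..n}"
    by auto
  moreover have "map x [1..<Suc n] ! (j - 1) = x j"
    using assms(2) by (subst nth_map) (auto simp del: upt_Suc)
  ultimately show ?thesis
    by simp
qed

lemma krawtchouk_root_eq:
  assumes "krawtchouk_zeros n p N x" "j \<in> {1..n}"
  shows "krawtchouk_root n p N j = x j"
  unfolding krawtchouk_root_def krawtchouk_zeros_set[OF assms(1)]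
  using sorted_list_of_set_image[OF krawtchouk_zeros_strict_mono[OF assms(1)] assms(2)] .

lemma krawtchouk_zeros_krawtchouk_root:
  assumes "0 < p" "p < 1" "n \<le> N"
  shows "krawtchouk_zeros n p N (krawtchouk_root n p N)"
proof -
  obtain x where x: "krawtchouk_zeros n p N x"
    using krawtchouk_zeros_exist[OF assms] by blast
  have "(\<Prod>j=1..n. [:1, - 1 / krawtchouk_root n p N j:]) = (\<Prod>j=1..n. [:1, - 1 / x j:])"
    by (intro prod.cong) (auto simp: krawtchouk_root_eq[OF x])
  with x show ?thesis
    by (auto simp: krawtchouk_zeros_def krawtchouk_root_eq[OF x])
qed

section \<open>Monotonicity in \<open>N\<close>\<close>

text \<open>The polynomial for \<open>N\<close> is a positive combination of that for \<open>N + 1\<close> and its unit shift, so it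
  changes sign between \<open>w j - 1\<close> and \<open>w j\<close> for each zero \<open>w j\<close> of the latter.\<close>

lemma krawtchouk_root_less_Suc:
  assumes p: "0 < p" "p < 1" and n: "n \<le> N" and j: "j \<in> {1..n}"
  shows "krawtchouk_root n p N j < krawtchouk_root n p (Suc N) j"
proof -
  let ?w = "krawtchouk_root n p (Suc N)"
  let ?K = "poly (krawtchouk n p N)" and ?Q = "poly (krawtchouk n p (Suc N))"
  have w: "krawtchouk_zeros n p (Suc N) ?w"
    using krawtchouk_zeros_krawtchouk_root[OF p, of n "Suc N"] n by simp
  define c where "c = (real (Suc N) - real n) / real (Suc N)"
  have c: "c > 0" using n by (simp add: c_def)
  have A: "c * ?K y = (1 - p) * ?Q y + p * ?Q (y + 1)" for y
    using krawtchouk_average[of p n N y] p n j by (simp add: c_def)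
  have ex: "\<exists>v. ?w i - 1 < v \<and> v < ?w i \<and> ?K v = 0" if i: "i \<in> {1..n}" for i
  proof -
    \<comment> \<open>At \<open>?w i\<close> the first term of the average vanishes, and exactly
      \<open>i\<close> zeros of \<open>?Q\<close> lie below \<open>?w i + 1\<close>.\<close>
    have eq: "c * ?K (?w i) = p * ?Q (?w i + 1)"
      using krawtchouk_zerosD(5)[OF w i] by (simp add: A)
    have "sgn (?Q (?w i + 1)) = (- 1) ^ i"
    proof (rule krawtchouk_zeros_sgn[OF w])
      fix k assume "k \<in> {1..i}"
      then show "?w k < ?w i + 1"
        using krawtchouk_zerosD(3)[OF w, of k i] i by (cases "k = i") auto
    qed (use krawtchouk_zerosD(3)[OF w, of i] i in auto)
    with sgn_eq_of_pos_multiples[OF eq] c p have hi: "sgn (?K (?w i)) = (- 1) ^ i"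
      by simp
    \<comment> \<open>One unit lower the second term vanishes, and only \<open>i - 1\<close> zeros
      lie below, whence the opposite sign.\<close>
    have eq: "c * ?K (?w i - 1) = (1 - p) * ?Q (?w i - 1)"
      using krawtchouk_zerosD(5)[OF w i] by (simp add: A)
    have "sgn (?Q (?w i - 1)) = (- 1) ^ (i - 1)"
    proof (rule krawtchouk_zeros_sgn[OF w])
      fix k assume "k \<in> {1..i - 1}"
      then have "1 \<le> k" "k < i" using i by auto
      then show "?w k < ?w i - 1"
        using krawtchouk_zerosD(3)[OF w, of k i] i by auto
    next
      fix k assume "k \<in> {Suc (i - 1)..n}"
      then show "?w i - 1 < ?w k"
        using krawtchouk_zerosD(3)[OF w, of i k] i by (cases "k = i") auto
    qed (use i in auto)
    with sgn_eq_of_pos_multiples[OF eq] c p have lo: "sgn (?K (?w i - 1)) = (- 1) ^ (i - 1)"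
      by simp
    have "(- 1) ^ i = - ((- 1 :: real) ^ (i - 1))"
      using i by (cases i) auto
    moreover have "?K (?w i - 1) \<noteq> 0" using lo by auto
    ultimately show ?thesis using hi lo
      poly_root_between[of "?w i - 1" "?w i" "krawtchouk n p N"] by simp
  qed
  define v where "v i = (SOME v. ?w i - 1 < v \<and> v < ?w i \<and> ?K v = 0)" for i
  have v: "?w i - 1 < v i" "v i < ?w i" "?K (v i) = 0" if "i \<in> {1..n}" for i
    using someI_ex[OF ex[OF that]] unfolding v_def by auto
  have mono: "strict_mono_on {1..n} v"
  proof (rule strict_mono_onI)
    fix i k assume ik: "i \<in> {1..n}" "k \<in> {1..n}" "i < k"
    \<comment> \<open>The chain is \<open>v i < ?w i < ?w k - 1 < v k\<close>.\<close>
    then show "v i < v k"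
      using v[OF ik(1)] v[OF ik(2)] krawtchouk_zerosD(3)[OF w, of i k] by auto
  qed
  obtain x where x: "krawtchouk_zeros n p N x"
    using krawtchouk_zeros_exist[OF p n] by blast
  \<comment> \<open>\<open>?K\<close> has exactly \<open>n\<close> zeros, so the \<open>n\<close>
    distinct zeros \<open>v i\<close> are all of them, already in increasing order.\<close>
  have "v ` {1..n} = {y. ?K y = 0}"
  proof (rule card_subset_eq)
    show "card (v ` {1..n}) = card {y. ?K y = 0}"
      unfolding krawtchouk_zeros_set[OF x]
      using mono krawtchouk_zeros_strict_mono[OF x]
      by (simp add: card_image strict_mono_on_imp_inj_on)
    show "finite {y. ?K y = 0}"
      unfolding krawtchouk_zeros_set[OF x] by simp
    show "v ` {1..n} \<subseteq> {y. ?K y = 0}"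
      using v(3) by auto
  qed
  then have "krawtchouk_root n p N j = v j"
    unfolding krawtchouk_root_def using sorted_list_of_set_image[OF mono j] by simp
  with v[OF j] show ?thesis by simp
qed

lemma krawtchouk_root_less:
  assumes "0 < p" "p < 1" "n \<le> N" "j \<in> {1..n}" "N < M"
  shows "krawtchouk_root n p N j < krawtchouk_root n p M j"
  using \<open>N < M\<close>
proof (induction M)
  case (Suc M)
  then show ?case
    using krawtchouk_root_less_Suc[OF assms(1,2) _ assms(4), of M] assms(3)
    by (cases "N = M") auto
qed simp

section \<open>Equilibrium\<close>

text \<open>Strict convexity in tangent form, by the mean value theorem. All conditions concern only
  the segment between the two points, since potential and field are controlled only on part of the
  line.\<close>

lemma tangent_less:
  fixes f f' :: "real \<Rightarrow> real"
  assumes deriv: "\<And>t. min x y \<le> t \<Longrightarrow> t \<le> max x y \<Longrightarrow> (f has_real_derivative f' t) (at t)"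
    and mono: "\<And>s t. min x y \<le> s \<Longrightarrow> s < t \<Longrightarrow> t \<le> max x y \<Longrightarrow> f' s < f' t"
    and "x \<noteq> y"
  shows "f x + f' x * (y - x) < f y"
proof (cases "x < y")
  case True
  then obtain z where z: "x < z" "z < y" "f y - f x = (y - x) * f' z"
    using MVT2[of x y f f'] deriv by auto
  then have "(y - x) * f' x < (y - x) * f' z"
    using mono[of x z] True by simp
  with z(3) show ?thesis by (simp add: mult.commute)
next
  case False
  with \<open>x \<noteq> y\<close> have "y < x" by simp
  then obtain z where z: "y < z" "z < x" "f x - f y = (x - y) * f' z"
    using MVT2[of y x f f'] deriv by auto
  then have "(x - y) * f' z < (x - y) * f' x"
    using mono[of z x] \<open>y < x\<close> by simp
  with z(3) show ?thesis by (simp add: algebra_simps)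
qed

section \<open>Convexity of the pair potential and of the field\<close>

lemma charge_potential_eq: "charge_potential x y = charge_potential 0 (y - x)"
  by (simp add: charge_potential_def)

lemma ln_ratio_minus:
  fixes d :: real
  shows "ln ((- d + 1) / (- d - 1)) = - ln ((d + 1) / (d - 1))"
proof -
  have "(- d + 1) / (- d - 1) = inverse ((d + 1) / (d - 1))"
    using minus_divide_divide[of "d - 1" "d + 1"] by simp
  moreover have "ln (inverse ((d + 1) / (d - 1))) = - ln ((d + 1) / (d - 1))"
    by (rule ln_inverse)
  ultimately show ?thesis by simp
qed

lemma charge_potential_even: "charge_potential 0 (- d) = charge_potential 0 d"
proof -
  have "(- d + 1) * (- d - 1) = (d + 1) * (d - 1)"
    by (simp add: algebra_simps)
  with ln_ratio_minus[of d] show ?thesis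
    by (simp add: charge_potential_def)
qed

text \<open>For \<open>d > 1\<close> the logarithms split and the potential becomes
  \<open>1 / 2 * ((d - 1) * ln (d - 1) - (d + 1) * ln (d + 1))\<close>.\<close>

lemma has_real_derivative_charge_potential:
  assumes "1 < d"
  shows "(charge_potential 0 has_real_derivative - (1 / 2) * ln ((d + 1) / (d - 1))) (at d)"
proof -
  have "((\<lambda>d. (d - 1) * ln (d - 1)) has_real_derivative ln (d - 1) + 1) (at d)"
    "((\<lambda>d. (d + 1) * ln (d + 1)) has_real_derivative ln (d + 1) + 1) (at d)"
    using assms by (auto intro!: derivative_eq_intros)
  from DERIV_cmult[OF DERIV_diff[OF this], of "1 / 2"]
  have "((\<lambda>d. 1 / 2 * ((d - 1) * ln (d - 1) - (d + 1) * ln (d + 1)))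
      has_real_derivative - (1 / 2) * ln ((d + 1) / (d - 1))) (at d)"
    using assms by (simp add: ln_div minus_divide_left del: divide_minus_left)
  then show ?thesis
  proof (rule has_field_derivative_transform_within_open[of _ _ _ "{1<..}"])
    fix e :: real assume "e \<in> {1<..}"
    then show "1 / 2 * ((e - 1) * ln (e - 1) - (e + 1) * ln (e + 1)) = charge_potential 0 e"
      by (simp add: charge_potential_def ln_div ln_mult) (simp add: field_simps)
  qed (use assms in auto)
qed

text \<open>For \<open>d > 1\<close> this is the derivative of \<open>charge_potential 0\<close>;
  the same formula continues it to an odd function.\<close>

definition charge_slope :: "real \<Rightarrow> real" where
  "charge_slope d = - (1 / 2) * ln ((d + 1) / (d - 1))"

lemma charge_slope_minus: "charge_slope (- d) = - charge_slope d"
  using ln_ratio_minus[of d] by (simp add: charge_slope_def)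

lemma charge_potential_tangent_pos:
  assumes "1 < d" "1 < e"
  shows "charge_potential 0 d + charge_slope d * (e - d) \<le> charge_potential 0 e"
proof (cases "d = e")
  case False
  \<comment> \<open>\<open>(d + 1) / (d - 1) = 1 + 2 / (d - 1)\<close> decreases for
    \<open>d > 1\<close>, so the potential is strictly convex there.\<close>
  have "charge_slope s < charge_slope t" if "1 < s" "s < t" for s t
  proof -
    have "(t + 1) / (t - 1) < (s + 1) / (s - 1)"
      using that by (simp add: divide_simps) (simp add: algebra_simps)
    then show ?thesis
      using that by (simp add: charge_slope_def)
  qed
  then show ?thesis
    using tangent_less[of d e "charge_potential 0" charge_slope] False assms
      has_real_derivative_charge_potential
    by (auto simp: charge_slope_def intro!: less_imp_le)
qed simp

text \<open>The two differences lie on the same side of the excluded band, as they do for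
  configurations in the same order; the negative side is reflected to the positive one by
  evenness.\<close>

lemma charge_potential_tangent:
  assumes "1 < d \<and> 1 < e \<or> d < - 1 \<and> e < - 1"
  shows "charge_potential 0 d + charge_slope d * (e - d) \<le> charge_potential 0 e"
proof (cases "1 < d \<and> 1 < e")
  case True
  then show ?thesis using charge_potential_tangent_pos by simp
next
  case False
  with assms have "1 < - d" "1 < - e" by auto
  with charge_potential_tangent_pos[OF this] charge_potential_even[of d]
    charge_potential_even[of e] charge_slope_minus[of d]
  show ?thesis by (simp add: algebra_simps)
qed

text \<open>\<open>(N - u) / u = N / u - 1\<close> decreases in \<open>u\<close>; hence a field with
  this force is strictly convex.\<close>

lemma krawtchouk_force_antimono:
  assumes "0 < p" "p < 1" "0 < s" "s < t" "t < real N"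
  shows "krawtchouk_force p N t < krawtchouk_force p N s"
proof -
  have "(real N - t) / t < (real N - s) / s"
    using assms by (simp add: divide_simps) (simp add: algebra_simps)
  moreover have "p * (real N - u) / ((1 - p) * u) = p / (1 - p) * ((real N - u) / u)" for u
    by simp
  ultimately have "p * (real N - t) / ((1 - p) * t) < p * (real N - s) / ((1 - p) * s)"
    using assms by (simp only: mult_strict_left_mono divide_pos_pos diff_gt_0_iff_gt)
  moreover have "0 < p * (real N - t) / ((1 - p) * t)"
    using assms by simp
  ultimately show ?thesis
    by (simp add: krawtchouk_force_def)
qed

text \<open>The energy depends only on the set of positions, so relabelling the charges does not
  change it.\<close>

lemma energy_image:
  assumes "inj_on x {1..n}"
  shows "energy \<phi> n x = (\<Sum>a\<in>x ` {1..n}. \<Sum>b\<in>x ` {1..n} - {a}. charge_potential b a)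
      + 2 * (\<Sum>a\<in>x ` {1..n}. \<phi> a)"
proof -
  have "x ` {1..n} - {x j} = x ` ({1..n} - {j})" if "j \<in> {1..n}" for j
    using inj_on_image_set_diff[OF assms, of "{1..n}" "{j}"] that by simp
  then have "(\<Sum>b\<in>x ` {1..n} - {x j}. charge_potential b (x j))
      = (\<Sum>k\<in>{1..n} - {j}. charge_potential (x k) (x j))" if "j \<in> {1..n}" for j
    using assms that by (simp add: sum.reindex inj_on_diff)
  then have "(\<Sum>j=1..n. \<Sum>b\<in>x ` {1..n} - {x j}. charge_potential b (x j))
      = (\<Sum>j=1..n. \<Sum>k\<in>{1..n} - {j}. charge_potential (x k) (x j))"
    by (rule sum.cong[OF refl])
  then show ?thesis
    unfolding energy_def sum.reindex[OF assms] comp_def by simp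
qed

text \<open>\<open>admissible\<close> leaves the order of the points open, whereas the convexity
  argument compares ordered configurations. Sorting keeps the energy and turns distances into
  directed gaps.\<close>

lemma admissible_sort:
  assumes "admissible \<alpha> \<beta> n y"
  obtains z where "energy \<phi> n z = energy \<phi> n y"
    and "\<And>j. j \<in> {1..n} \<Longrightarrow> \<alpha> < z j \<and> z j < \<beta>"
    and "\<And>i j. i \<in> {1..n} \<Longrightarrow> j \<in> {1..n} \<Longrightarrow> i < j \<Longrightarrow> z i + 1 < z j"
proof -
  have inj: "inj_on y {1..n}"
    using assms by (fastforce simp: admissible_def inj_on_def)
  define l where "l = sorted_list_of_set (y ` {1..n})"
  define z where "z j = l ! (j - 1)" for j
  have l: "set l = y ` {1..n}" "length l = n" "sorted_wrt (<) l"
    using inj by (simp_all add: l_def card_image)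
  have less: "z i < z j" if "i \<in> {1..n}" "j \<in> {1..n}" "i < j" for i j
    using that l(2) sorted_wrt_nth_less[OF l(3), of "i - 1" "j - 1"] by (auto simp: z_def)
  have "z ` {1..n} = set l"
  proof -
    have "z ` {1..n} = (\<lambda>j. z (Suc j)) ` {..<n}"
      by (simp only: image_Suc_lessThan [symmetric] image_image)
    also have "\<dots> = set l"
      using l(2) by (auto simp: z_def set_conv_nth)
    finally show ?thesis .
  qed
  then have im: "z ` {1..n} = y ` {1..n}" using l(1) by simp
  have inj': "inj_on z {1..n}"
    by (rule linorder_inj_onI') (use less in force)
  show ?thesis
  proof
    show "energy \<phi> n z = energy \<phi> n y"
      unfolding energy_image[OF inj] energy_image[OF inj'] im ..
    have z: "\<exists>k\<in>{1..n}. z j = y k" if "j \<in> {1..n}" for j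
      using im that by blast
    show "\<alpha> < z j \<and> z j < \<beta>" if "j \<in> {1..n}" for j
      using z[OF that] assms by (auto simp: admissible_def)
    show "z i + 1 < z j" if ij: "i \<in> {1..n}" "j \<in> {1..n}" "i < j" for i j
    proof -
      obtain a b where "a \<in> {1..n}" "b \<in> {1..n}" "z i = y a" "z j = y b"
        using z ij by meson
      moreover from this have "a \<noteq> b"
        using less[OF ij] by auto
      ultimately have "\<bar>z i - z j\<bar> > 1"
        using assms by (auto simp: admissible_def)
      then show ?thesis using less[OF ij] by auto
    qed
  qed
qed

text \<open>The pairwise slopes are antisymmetric, so the first-order term of the double sum is
  twice a sum over single indices, which the balance condition cancels.\<close>

lemma energy_less_of_balance:
  assumes balance: "\<And>j. j \<in> {1..n} \<Longrightarrow>
      (\<Sum>k\<in>{1..n} - {j}. charge_slope (x j - x k)) + f (x j) = 0"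
    and x: "\<And>i j. i \<in> {1..n} \<Longrightarrow> j \<in> {1..n} \<Longrightarrow> i < j \<Longrightarrow> x i + 1 < x j"
    and z: "\<And>i j. i \<in> {1..n} \<Longrightarrow> j \<in> {1..n} \<Longrightarrow> i < j \<Longrightarrow> z i + 1 < z j"
    and \<phi>: "\<And>j. j \<in> {1..n} \<Longrightarrow> z j \<noteq> x j \<Longrightarrow> \<phi> (x j) + f (x j) * (z j - x j) < \<phi> (z j)"
    and i: "i \<in> {1..n}" "z i \<noteq> x i"
  shows "energy \<phi> n x < energy \<phi> n z"
proof -
  define h where "h j = z j - x j" for j
  let ?I = "{1..n}" and ?s = "\<lambda>j k. charge_slope (x j - x k)"
  have pair: "charge_potential (x k) (x j) + ?s j k * (h j - h k) \<le> charge_potential (z k) (z j)"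
    if "j \<in> ?I" "k \<in> ?I - {j}" for j k
  proof -
    have "1 < x j - x k \<and> 1 < z j - z k \<or> x j - x k < - 1 \<and> z j - z k < - 1"
      using x[of j k] x[of k j] z[of j k] z[of k j] that by (cases "j < k") auto
    from charge_potential_tangent[OF this] show ?thesis
      by (simp add: charge_potential_eq[of "x k"] charge_potential_eq[of "z k"] h_def algebra_simps)
  qed
  have anti: "?s k j * h j = - (?s j k * h j)" for j k
    using charge_slope_minus[of "x j - x k"] by simp
  have swap: "(\<Sum>j\<in>?I. \<Sum>k\<in>?I - {j}. F j k) = (\<Sum>j\<in>?I. \<Sum>k\<in>?I - {j}. F k j)"
    for F :: "nat \<Rightarrow> nat \<Rightarrow> real"
  proof -
    have "(\<Sum>j\<in>?I. \<Sum>k\<in>?I - {j}. F j k) = (\<Sum>j\<in>?I. \<Sum>k\<in>{k\<in>?I. k \<noteq> j}. F j k)"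
      by (intro sum.cong) auto
    also have "\<dots> = (\<Sum>k\<in>?I. \<Sum>j\<in>{j\<in>?I. k \<noteq> j}. F j k)"
      by (rule sum.swap_restrict) auto
    also have "\<dots> = (\<Sum>j\<in>?I. \<Sum>k\<in>?I - {j}. F k j)"
      by (intro sum.cong) auto
    finally show ?thesis .
  qed
  have "(\<Sum>j\<in>?I. \<Sum>k\<in>?I - {j}. ?s j k * h k) = (\<Sum>j\<in>?I. \<Sum>k\<in>?I - {j}. ?s k j * h j)"
    by (rule swap)
  also have "\<dots> = (\<Sum>j\<in>?I. \<Sum>k\<in>?I - {j}. - (?s j k * h j))"
    by (simp only: anti)
  finally have "(\<Sum>j\<in>?I. \<Sum>k\<in>?I - {j}. ?s j k * (h j - h k))
      = 2 * (\<Sum>j\<in>?I. \<Sum>k\<in>?I - {j}. ?s j k * h j)"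
    by (simp add: right_diff_distrib sum_subtractf sum_negf)
  \<comment> \<open>Each balance condition is multiplied by the displacement \<open>h j\<close>, and
    the results are summed.\<close>
  moreover have "(\<Sum>j\<in>?I. \<Sum>k\<in>?I - {j}. ?s j k * h j) + (\<Sum>j\<in>?I. f (x j) * h j) = 0"
    using balance by (simp flip: sum_distrib_right sum.distrib distrib_right)
  ultimately have first_order:
    "(\<Sum>j\<in>?I. \<Sum>k\<in>?I - {j}. ?s j k * (h j - h k)) + 2 * (\<Sum>j\<in>?I. f (x j) * h j) = 0"
    by simp
  have "(\<Sum>j\<in>?I. \<Sum>k\<in>?I - {j}. charge_potential (x k) (x j) + ?s j k * (h j - h k))
      \<le> (\<Sum>j\<in>?I. \<Sum>k\<in>?I - {j}. charge_potential (z k) (z j))"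
    by (intro sum_mono pair)
  \<comment> \<open>Strictness comes from the field, at the index \<open>i\<close> that moves: a
    common translation would leave all pair potentials unchanged.\<close>
  moreover have "(\<Sum>j\<in>?I. \<phi> (x j) + f (x j) * h j) < (\<Sum>j\<in>?I. \<phi> (z j))"
  proof (rule sum_strict_mono_ex1)
    show "\<forall>j\<in>?I. \<phi> (x j) + f (x j) * h j \<le> \<phi> (z j)"
    proof
      fix j assume "j \<in> ?I"
      then show "\<phi> (x j) + f (x j) * h j \<le> \<phi> (z j)"
        using \<phi>[of j] by (cases "z j = x j") (auto simp: h_def)
    qed
    show "\<exists>j\<in>?I. \<phi> (x j) + f (x j) * h j < \<phi> (z j)"
      using \<phi>[OF i] i(1) by (auto simp: h_def)
  qed simp
  ultimately show ?thesis
    using first_order by (simp add: energy_def sum.distrib)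
qed

text \<open>At a zero the difference equation relates the values at \<open>x j + 1\<close> and
  \<open>x j - 1\<close>. By the factorization their ratio is minus the product of all
  \<open>(d k + 1) / (d k - 1)\<close>, and the logarithm of the resulting identity is a multiple of
  the force balance.\<close>

lemma krawtchouk_zeros_balance:
  assumes p: "0 < p" "p < 1" and n: "n \<le> N" and x: "krawtchouk_zeros n p N x" and j: "j \<in> {1..n}"
  shows "(\<Sum>k\<in>{1..n} - {j}. charge_slope (x j - x k)) - krawtchouk_force p N (x j) = 0"
proof -
  let ?J = "{1..n} - {j}" and ?K = "poly (krawtchouk n p N)"
  define d where "d k = x j - x k" for k
  have xj: "0 < x j" "x j < real N"
    using krawtchouk_zerosD(1,2)[OF x j] by auto
  have xk: "x k \<noteq> 0" if "k \<in> ?J" for k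
    using krawtchouk_zerosD(1)[OF x, of k] that by auto
  have d: "1 < \<bar>d k\<bar>" if "k \<in> ?J" for k
    using that krawtchouk_zerosD(3)[OF x, of j k] krawtchouk_zerosD(3)[OF x, of k j] j
    by (cases "j < k") (auto simp: d_def)
  \<comment> \<open>Distances greater than 1 give numerator and denominator the same sign, so the
    logarithm of the product splits.\<close>
  have dpos: "0 < (d k + 1) / (d k - 1)" if "k \<in> ?J" for k
    using d[OF that] by (auto simp: zero_less_divide_iff)
  \<comment> \<open>The factor of \<open>j\<close> itself contributes \<open>- (t / x j)\<close>,
    which has opposite signs at \<open>t = 1\<close> and \<open>t = - 1\<close>.\<close>
  have K: "?K (x j + t) = - (t / x j) * (\<Prod>k\<in>?J. (d k + t) * (- 1 / x k))" for t
  proof -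
    have "?K (x j + t) = (1 - (x j + t) / x j) * (\<Prod>k\<in>?J. 1 - (x j + t) / x k)"
      unfolding krawtchouk_zerosD(4)[OF x] poly_prod_roots using j by (simp add: prod.remove)
    moreover have "1 - (x j + t) / x j = - (t / x j)"
      using xj by (simp add: field_simps)
    moreover have "1 - (x j + t) / x k = (d k + t) * (- 1 / x k)" if "k \<in> ?J" for k
      using xk[OF that] by (simp add: d_def field_simps)
    ultimately show ?thesis by simp
  qed
  let ?A = "\<Prod>k\<in>?J. d k + 1" and ?B = "\<Prod>k\<in>?J. d k - 1" and ?C = "\<Prod>k\<in>?J. - 1 / x k"
  have KA: "?K (x j + 1) = - (1 / x j) * (?A * ?C)" and KB: "?K (x j - 1) = 1 / x j * (?B * ?C)"
    using K[of 1] K[of "- 1"] unfolding prod.distrib by simp_all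
  have C: "?C \<noteq> 0" and B: "?B \<noteq> 0"
    using xk d by (force simp: prod_zero_iff)+
  have "p * (real N - x j) * ?K (x j + 1) + (1 - p) * x j * ?K (x j - 1) = 0"
    using krawtchouk_difference_equation[of p n N "x j"] p n krawtchouk_zerosD(5)[OF x j] by simp
  moreover have "q * (- (1 / u) * (a * c)) + (1 - p) * u * (1 / u * (b * c))
      = c / u * ((1 - p) * u * b - q * a)" for a b c q u :: real
    by (cases "u = 0") (simp_all add: field_simps)
  ultimately have "(?C / x j) * ((1 - p) * x j * ?B - p * (real N - x j) * ?A) = 0"
    unfolding KA KB by (simp only:)
  then have "p * (real N - x j) * ?A = (1 - p) * x j * ?B"
    using C xj by simp
  moreover have "(1 - p) * x j * ?B \<noteq> 0"
    using B p xj by simp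
  ultimately have "p * (real N - x j) / ((1 - p) * x j) * (?A / ?B) = 1"
    by (simp only: times_divide_times_eq divide_eq_1_iff simp_thms)
  then have "p * (real N - x j) / ((1 - p) * x j) * (\<Prod>k\<in>?J. (d k + 1) / (d k - 1)) = 1"
    unfolding prod_dividef .
  then have "ln (p * (real N - x j) / ((1 - p) * x j) * (\<Prod>k\<in>?J. (d k + 1) / (d k - 1))) = 0"
    by simp
  moreover have "0 < p * (real N - x j) / ((1 - p) * x j)"
    using p xj by simp
  moreover have "0 < (\<Prod>k\<in>?J. (d k + 1) / (d k - 1))"
    using dpos by (rule prod_pos)
  ultimately have "ln (p * (real N - x j) / ((1 - p) * x j))
      + ln (\<Prod>k\<in>?J. (d k + 1) / (d k - 1)) = 0"
    by (simp only: ln_mult_pos)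
  moreover have "ln (\<Prod>k\<in>?J. (d k + 1) / (d k - 1)) = (\<Sum>k\<in>?J. ln ((d k + 1) / (d k - 1)))"
    using dpos by (intro ln_prod) force+
  ultimately show ?thesis
    by (simp add: charge_slope_def krawtchouk_force_def d_def sum_negf flip: sum_divide_distrib)
qed

text \<open>The strict energy inequality \<open>less\<close> serves twice: it makes \<open>x\<close>
  minimal and rules out any other minimizer.\<close>

lemma krawtchouk_zeros_equilibrium:
  assumes p: "0 < p" "p < 1" and n: "n \<le> N" and x: "krawtchouk_zeros n p N x"
    and \<phi>: "\<And>t. 0 < t \<Longrightarrow> t < real N \<Longrightarrow> (\<phi> has_real_derivative - krawtchouk_force p N t) (at t)"
  shows "equilibrium_distribution \<phi> 0 (real N) n x"
    and "equilibrium_distribution \<phi> 0 (real N) n y \<Longrightarrow> j \<in> {1..n} \<Longrightarrow> y j = x j"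
proof -
  have gap: "x i + 1 < x j" if "i \<in> {1..n}" "j \<in> {1..n}" "i < j" for i j
    using krawtchouk_zerosD(3)[OF x] that by simp
  have less: "energy \<phi> n x < energy \<phi> n z"
    if z: "\<And>j. j \<in> {1..n} \<Longrightarrow> 0 < z j \<and> z j < real N"
      "\<And>i j. i \<in> {1..n} \<Longrightarrow> j \<in> {1..n} \<Longrightarrow> i < j \<Longrightarrow> z i + 1 < z j"
      and i: "i \<in> {1..n}" "z i \<noteq> x i" for z i
  proof (rule energy_less_of_balance[of n x "\<lambda>t. - krawtchouk_force p N t" z \<phi>, OF _ gap z(2) _ i])
    fix j assume j: "j \<in> {1..n}"
    show "(\<Sum>k\<in>{1..n} - {j}. charge_slope (x j - x k)) + - krawtchouk_force p N (x j) = 0"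
      using krawtchouk_zeros_balance[OF p n x j] by simp
    assume "z j \<noteq> x j"
    then show "\<phi> (x j) + - krawtchouk_force p N (x j) * (z j - x j) < \<phi> (z j)"
      using z(1)[OF j] krawtchouk_zerosD(1,2)[OF x j] krawtchouk_force_antimono[OF p] \<phi>
      by (intro tangent_less[of "x j" "z j" \<phi> "\<lambda>t. - krawtchouk_force p N t"]) auto
  qed
  \<comment> \<open>A competitor may list its points in any order, so it is sorted first; equality
    occurs only when the sorted copy agrees with \<open>x\<close>.\<close>
  have le: "energy \<phi> n x \<le> energy \<phi> n y" if adm: "admissible 0 (real N) n y" for y
  proof -
    obtain z where z: "energy \<phi> n z = energy \<phi> n y"
      "\<And>j. j \<in> {1..n} \<Longrightarrow> 0 < z j \<and> z j < real N"
      "\<And>i j. i \<in> {1..n} \<Longrightarrow> j \<in> {1..n} \<Longrightarrow> i < j \<Longrightarrow> z i + 1 < z j"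
      using admissible_sort[OF adm, of \<phi>] by blast
    show ?thesis
    proof (cases "\<forall>i\<in>{1..n}. z i = x i")
      case True
      then have "energy \<phi> n z = energy \<phi> n x"
        by (simp add: energy_def)
      with z(1) show ?thesis by simp
    next
      case False
      then show ?thesis using less[OF z(2,3)] z(1) by fastforce
    qed
  qed
  then show "equilibrium_distribution \<phi> 0 (real N) n x"
    using x by (auto simp: equilibrium_distribution_def krawtchouk_zeros_def)
  \<comment> \<open>Uniqueness tests a second equilibrium against \<open>x\<close>, which therefore
    has to count as a competitor.\<close>
  have x_adm: "admissible 0 (real N) n x"
    unfolding admissible_def
  proof (intro conjI ballI impI)
    fix i k assume "i \<in> {1..n}" "k \<in> {1..n}" "i \<noteq> k"
    then show "1 < \<bar>x i - x k\<bar>"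
      using gap[of i k] gap[of k i] by (cases "i < k") auto
  qed (use krawtchouk_zerosD(1,2)[OF x] in auto)
  assume y: "equilibrium_distribution \<phi> 0 (real N) n y" and j: "j \<in> {1..n}"
  show "y j = x j"
  proof (rule ccontr)
    assume "y j \<noteq> x j"
    moreover have "y i + 1 < y k" if "i \<in> {1..n}" "k \<in> {1..n}" "i < k" for i k
      using gap_mono[of 1 n y i k] y that by (auto simp: equilibrium_distribution_def)
    ultimately have "energy \<phi> n x < energy \<phi> n y"
      using y j by (intro less[of y j]) (auto simp: equilibrium_distribution_def)
    moreover have "energy \<phi> n y \<le> energy \<phi> n x"
      using y x_adm by (auto simp: equilibrium_distribution_def)
    ultimately show False by simp
  qed
qed

section \<open>Complex zeros and their multiplicities\<close>

lemma map_poly_of_real_mult: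
  "map_poly (of_real :: real \<Rightarrow> complex) (q * r) = map_poly of_real q * map_poly of_real r"
  by (rule poly_eqI) (simp add: coeff_map_poly coeff_mult)

lemma map_poly_of_real_prod:
  "map_poly (of_real :: real \<Rightarrow> complex) (\<Prod>i\<in>A. f i) = (\<Prod>i\<in>A. map_poly of_real (f i))"
  by (induction A rule: infinite_finite_induct) (simp_all add: map_poly_of_real_mult)

text \<open>Factor \<open>j\<close> is a nonzero multiple of \<open>[:- a j, 1:]\<close>, and by
  injectivity the remaining factors do not vanish at \<open>a j\<close>.\<close>

lemma order_prod_linear:
  fixes a :: "'i \<Rightarrow> 'a::field"
  assumes "finite A" "inj_on a A" "j \<in> A" "\<And>i. i \<in> A \<Longrightarrow> a i \<noteq> 0"
  shows "order (a j) (\<Prod>i\<in>A. [:1, - 1 / a i:]) = 1"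
proof -
  let ?r = "\<Prod>i\<in>A - {j}. [:1, - 1 / a i:]"
  have aj: "a j \<noteq> 0" using assms by simp
  have "[:1, - 1 / a j:] = smult (- 1 / a j) [:- a j, 1:]"
    using aj by simp
  then have eq: "(\<Prod>i\<in>A. [:1, - 1 / a i:]) = [:- a j, 1:] ^ 1 * smult (- 1 / a j) ?r"
    using assms(1,3) by (simp only: prod.remove mult_smult_left mult_smult_right power_one_right)
  have nz: "poly (smult (- 1 / a j) ?r) (a j) \<noteq> 0"
    using assms aj by (auto simp: poly_prod prod_zero_iff inj_on_def)
  have "smult (- 1 / a j) ?r \<noteq> 0"
  proof
    assume "smult (- 1 / a j) ?r = 0"
    with nz show False by (simp only: poly_0 simp_thms)
  qed
  then have prod_nz: "[:- a j, 1:] ^ 1 * smult (- 1 / a j) ?r \<noteq> 0"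
    by (intro no_zero_divisors) simp_all
  show ?thesis
    unfolding eq order_mult[OF prod_nz] order_power_n_n order_0I[OF nz] by simp
qed

theorem mainTheorem8:
  fixes N n :: nat and p :: real
  assumes "0 < p" and "p < 1" and "1 \<le> n" and "n \<le> N"
  shows "{z::complex. poly (map_poly complex_of_real (krawtchouk n p N)) z = 0}
           = (\<lambda>j. complex_of_real (krawtchouk_root n p N j)) ` {1..n}
       \<and> strict_mono_on {1..n} (krawtchouk_root n p N)
       \<and> (\<forall>j\<in>{1..n}. order (complex_of_real (krawtchouk_root n p N j))
                            (map_poly complex_of_real (krawtchouk n p N)) = 1)
       \<and> (\<forall>j\<in>{1..n}. 0 < krawtchouk_root n p N j \<and> krawtchouk_root n p N j < real N)
       \<and> (\<forall>j\<in>{1..n}. \<forall>k\<in>{1..n}. j \<noteq> k \<longrightarrow>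
             \<bar>krawtchouk_root n p N j - krawtchouk_root n p N k\<bar> > 1)
       \<and> (\<forall>\<phi>::real \<Rightarrow> real.
             (\<forall>x. 0 < x \<and> x < real N \<longrightarrow>
                (\<phi> has_real_derivative - krawtchouk_force p N x) (at x)) \<longrightarrow>
             equilibrium_distribution \<phi> 0 (real N) n (krawtchouk_root n p N) \<and>
             (\<forall>y. equilibrium_distribution \<phi> 0 (real N) n y \<longrightarrow>
                (\<forall>j\<in>{1..n}. y j = krawtchouk_root n p N j)))
       \<and> (\<forall>M>N. \<forall>j\<in>{1..n}. krawtchouk_root n p N j < krawtchouk_root n p M j)"
proof -
  let ?x = "krawtchouk_root n p N"
  have x: "krawtchouk_zeros n p N ?x"
    using krawtchouk_zeros_krawtchouk_root assms by blast
  note mono = krawtchouk_zeros_strict_mono[OF x]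
  have nz: "complex_of_real (?x j) \<noteq> 0" if "j \<in> {1..n}" for j
    using krawtchouk_zerosD(1)[OF x that] by simp
  have inj: "inj_on (\<lambda>j. complex_of_real (?x j)) {1..n}"
    using strict_mono_on_imp_inj_on[OF mono] unfolding inj_on_def of_real_eq_iff .
  \<comment> \<open>The factorization into real linear factors carries over to the complex numbers,
    which excludes nonreal zeros and exhibits the multiplicities.\<close>
  have eq: "map_poly complex_of_real (krawtchouk n p N)
      = (\<Prod>j=1..n. [:1, - 1 / complex_of_real (?x j):])"
    by (subst krawtchouk_zerosD(4)[OF x]) (simp add: map_poly_of_real_prod map_poly_pCons)
  show ?thesis
  proof (intro conjI ballI allI impI)
    show "{z. poly (map_poly complex_of_real (krawtchouk n p N)) z = 0}
        = (\<lambda>j. complex_of_real (?x j)) ` {1..n}"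
      unfolding eq using nz by (auto simp: poly_prod prod_zero_iff)
    show "strict_mono_on {1..n} ?x" by (rule mono)
    show "order (complex_of_real (?x j)) (map_poly complex_of_real (krawtchouk n p N)) = 1"
      if "j \<in> {1..n}" for j
      unfolding eq by (rule order_prod_linear[OF _ inj that nz]) simp
    show "0 < ?x j" "?x j < real N" if "j \<in> {1..n}" for j
      using krawtchouk_zerosD(1,2)[OF x that] by auto
    show "\<bar>?x j - ?x k\<bar> > 1" if "j \<in> {1..n}" "k \<in> {1..n}" "j \<noteq> k" for j k
      using krawtchouk_zerosD(3)[OF x, of j k] krawtchouk_zerosD(3)[OF x, of k j] that
      by (cases "j < k") auto
    show "?x j < krawtchouk_root n p M j" if "N < M" "j \<in> {1..n}" for M j
      using krawtchouk_root_less assms that by blast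
    fix \<phi> :: "real \<Rightarrow> real"
    assume "\<forall>x. 0 < x \<and> x < real N \<longrightarrow> (\<phi> has_real_derivative - krawtchouk_force p N x) (at x)"
    then have \<phi>: "(\<phi> has_real_derivative - krawtchouk_force p N t) (at t)"
      if "0 < t" "t < real N" for t
      using that by blast
    show "equilibrium_distribution \<phi> 0 (real N) n ?x"
      using krawtchouk_zeros_equilibrium(1)[OF assms(1,2,4) x \<phi>] .
    show "y j = ?x j" if "equilibrium_distribution \<phi> 0 (real N) n y" "j \<in> {1..n}" for y j
      using krawtchouk_zeros_equilibrium(2)[OF assms(1,2,4) x \<phi> that] .
  qed
qed

end
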